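(* For a Latin square $L$ of order $n$, $\mathrm{mcs}(L)=3n-1-\mathrm{scc}(L)$.
   Context: A Latin square $L$ of order $n$ is identified with its set of entries $(r,c,s)$ (symbol $s$ in row $r$, column $c$). A line of $L$ is the set of entries in a fixed row, a fixed column, or with a fixed symbol. A cover-sequence for $L$ is a sequence $(e_1,\dots,e_d)$ of entries of $L$ such that (1) every row, column and symbol of $L$ is represented in $\{e_1,\dots,e_d\}$, and (2) for each $i$, $e_i$ contains a row, a column, or a symbol not represented in $\{e_1,\dots,e_{i-1}\}$; $\mathrm{mcs}(L)$ is the maximum length of a cover-sequence. A subsquare of $L$ is a subset of the entries of $L$ that is itself a Latin square (on its own set of rows, columns and symbols); a subsquare intersects a line $\ell$ if it contains an entry of $\ell$. A chain of $L$ is a sequence of subsquares $\emptyset=S_0\subseteq S_1\subseteq\cdots\subseteq S_\alpha=L$ where $S_1$ consists of a single entry. The chain is connected if for each $i$ with $1\le i\le\alpha$ there is a line $\ell$ intersecting $S_i$ but not $S_{i-1}$ such that $S_i$ is the smallest subsquare of $L$ that intersects $\ell$ and contains all entries of $S_{i-1}$. The length of the chain is $\alpha$, and $\mathrm{scc}(L)$ is the minimum length of a connected chain of $L$. *)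

theory Defs
  imports Main
begin

type_synonym ('r, 'c, 's) entry = "'r \<times> 'c \<times> 's"

abbreviation row_of :: "('r, 'c, 's) entry \<Rightarrow> 'r" where
  "row_of e \<equiv> fst e"

abbreviation col_of :: "('r, 'c, 's) entry \<Rightarrow> 'c" where
  "col_of e \<equiv> fst (snd e)"

abbreviation sym_of :: "('r, 'c, 's) entry \<Rightarrow> 's" where
  "sym_of e \<equiv> snd (snd e)"

definition rows :: "('r, 'c, 's) entry set \<Rightarrow> 'r set" where
  "rows E = row_of ` E"

definition cols :: "('r, 'c, 's) entry set \<Rightarrow> 'c set" where
  "cols E = col_of ` E"

definition syms :: "('r, 'c, 's) entry set \<Rightarrow> 's set" where
  "syms E = sym_of ` E"

text \<open>
  A Latin square is its set of entries; its rows, columns and symbols are those occurring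
  in some entry.  The empty set is the Latin square of order 0, so that it can serve
  as the initial subsquare of a chain.
\<close>

definition latin_square :: "nat \<Rightarrow> ('r, 'c, 's) entry set \<Rightarrow> bool" where
  "latin_square n L \<longleftrightarrow>
     finite L \<and> card (rows L) = n \<and> card (cols L) = n \<and> card (syms L) = n \<and>
     (\<forall>r \<in> rows L. \<forall>c \<in> cols L. \<exists>!s. (r, c, s) \<in> L) \<and>
     (\<forall>r \<in> rows L. \<forall>s \<in> syms L. \<exists>!c. (r, c, s) \<in> L) \<and>
     (\<forall>c \<in> cols L. \<forall>s \<in> syms L. \<exists>!r. (r, c, s) \<in> L)"

definition lines :: "('r, 'c, 's) entry set \<Rightarrow> ('r, 'c, 's) entry set set" where
  "lines L =
     {{e \<in> L. row_of e = r} | r. r \<in> rows L} \<union>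
     {{e \<in> L. col_of e = c} | c. c \<in> cols L} \<union>
     {{e \<in> L. sym_of e = s} | s. s \<in> syms L}"

definition cover_sequence :: "('r, 'c, 's) entry set \<Rightarrow> ('r, 'c, 's) entry list \<Rightarrow> bool" where
  "cover_sequence L es \<longleftrightarrow>
     set es \<subseteq> L \<and>
     rows (set es) = rows L \<and> cols (set es) = cols L \<and> syms (set es) = syms L \<and>
     (\<forall>i < length es.
        row_of (es ! i) \<notin> rows (set (take i es)) \<or>
        col_of (es ! i) \<notin> cols (set (take i es)) \<or>
        sym_of (es ! i) \<notin> syms (set (take i es)))"

definition mcs :: "('r, 'c, 's) entry set \<Rightarrow> nat" where
  "mcs L = Max {length es | es. cover_sequence L es}"

definition subsquare :: "('r, 'c, 's) entry set \<Rightarrow> ('r, 'c, 's) entry set \<Rightarrow> bool" where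
  "subsquare T L \<longleftrightarrow> T \<subseteq> L \<and> (\<exists>m. latin_square m T)"

definition intersects :: "('r, 'c, 's) entry set \<Rightarrow> ('r, 'c, 's) entry set \<Rightarrow> bool" where
  "intersects T l \<longleftrightarrow> T \<inter> l \<noteq> {}"

definition chain ::
    "('r, 'c, 's) entry set \<Rightarrow> nat \<Rightarrow> (nat \<Rightarrow> ('r, 'c, 's) entry set) \<Rightarrow> bool" where
  "chain L \<alpha> S \<longleftrightarrow>
     1 \<le> \<alpha> \<and>
     (\<forall>i \<le> \<alpha>. subsquare (S i) L) \<and>
     (\<forall>i < \<alpha>. S i \<subseteq> S (Suc i)) \<and>
     S 0 = {} \<and> (\<exists>e. S 1 = {e}) \<and> S \<alpha> = L"

text \<open>
  Smallest means having the fewest entries.  If the previous subsquare is nonempty, this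
  determines the new one uniquely, as the least subsquare with respect to inclusion (see
  \<open>smallest_subsquare_least\<close> below).  In the first step the previous subsquare is empty, and
  the smallest subsquares are the single entries of the line: any of them may be chosen.
  Requiring an inclusion-least subsquare there would rule out all connected chains
  for order at least 2.
\<close>

definition smallest_subsquare ::
    "('r, 'c, 's) entry set \<Rightarrow> ('r, 'c, 's) entry set \<Rightarrow> ('r, 'c, 's) entry set
      \<Rightarrow> ('r, 'c, 's) entry set \<Rightarrow> bool" where
  "smallest_subsquare L l P T \<longleftrightarrow>
     is_arg_min card (\<lambda>T. subsquare T L \<and> intersects T l \<and> P \<subseteq> T) T"

definition connected_chain ::
    "('r, 'c, 's) entry set \<Rightarrow> nat \<Rightarrow> (nat \<Rightarrow> ('r, 'c, 's) entry set) \<Rightarrow> bool" where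
  "connected_chain L \<alpha> S \<longleftrightarrow>
     chain L \<alpha> S \<and>
     (\<forall>i. 1 \<le> i \<and> i \<le> \<alpha> \<longrightarrow>
        (\<exists>l \<in> lines L. intersects (S i) l \<and> \<not> intersects (S (i - 1)) l \<and>
           smallest_subsquare L l (S (i - 1)) (S i)))"

definition scc :: "('r, 'c, 's) entry set \<Rightarrow> nat" where
  "scc L = (LEAST \<alpha>. \<exists>S. connected_chain L \<alpha> S)"

lemma latin_square_cell:
  assumes "latin_square n L"
  shows "r \<in> rows L \<Longrightarrow> c \<in> cols L \<Longrightarrow> \<exists>s. (r, c, s) \<in> L"
    and "r \<in> rows L \<Longrightarrow> s \<in> syms L \<Longrightarrow> \<exists>c. (r, c, s) \<in> L"
    and "c \<in> cols L \<Longrightarrow> s \<in> syms L \<Longrightarrow> \<exists>r. (r, c, s) \<in> L"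
proof -
  show "r \<in> rows L \<Longrightarrow> c \<in> cols L \<Longrightarrow> \<exists>s. (r, c, s) \<in> L"
    by (rule ex1_implies_ex) (use assms in \<open>simp add: latin_square_def\<close>)
  show "r \<in> rows L \<Longrightarrow> s \<in> syms L \<Longrightarrow> \<exists>c. (r, c, s) \<in> L"
    by (rule ex1_implies_ex) (use assms in \<open>simp add: latin_square_def\<close>)
  show "c \<in> cols L \<Longrightarrow> s \<in> syms L \<Longrightarrow> \<exists>r. (r, c, s) \<in> L"
    by (rule ex1_implies_ex) (use assms in \<open>simp add: latin_square_def\<close>)
qed

lemma entry_lines:
  assumes "(r, c, s) \<in> L"
  shows "r \<in> rows L" "c \<in> cols L" "s \<in> syms L"
  using assms by (force simp: rows_def cols_def syms_def)+

lemma latin_square_unique: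
  assumes "latin_square n L"
  shows "(r, c, s) \<in> L \<Longrightarrow> (r, c, s') \<in> L \<Longrightarrow> s = s'"
    and "(r, c, s) \<in> L \<Longrightarrow> (r, c', s) \<in> L \<Longrightarrow> c = c'"
    and "(r, c, s) \<in> L \<Longrightarrow> (r', c, s) \<in> L \<Longrightarrow> r = r'"
proof -
  have u: "r \<in> rows L \<Longrightarrow> c \<in> cols L \<Longrightarrow> \<exists>!s. (r, c, s) \<in> L"
    "r \<in> rows L \<Longrightarrow> s \<in> syms L \<Longrightarrow> \<exists>!c. (r, c, s) \<in> L"
    "c \<in> cols L \<Longrightarrow> s \<in> syms L \<Longrightarrow> \<exists>!r. (r, c, s) \<in> L"
    using assms by (simp_all add: latin_square_def)
  show "(r, c, s) \<in> L \<Longrightarrow> (r, c, s') \<in> L \<Longrightarrow> s = s'"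
    using u(1) entry_lines[of r c s L] by blast
  show "(r, c, s) \<in> L \<Longrightarrow> (r, c', s) \<in> L \<Longrightarrow> c = c'"
    using u(2) entry_lines[of r c s L] by blast
  show "(r, c, s) \<in> L \<Longrightarrow> (r', c, s) \<in> L \<Longrightarrow> r = r'"
    using u(3) entry_lines[of r c s L] by blast
qed

lemma subsquare_Int_cell:
  assumes L: "latin_square n L" and T: "subsquare T L" and U: "subsquare U L"
  shows "r \<in> rows T \<Longrightarrow> r \<in> rows U \<Longrightarrow> c \<in> cols T \<Longrightarrow> c \<in> cols U \<Longrightarrow> \<exists>s. (r, c, s) \<in> T \<inter> U"
    and "r \<in> rows T \<Longrightarrow> r \<in> rows U \<Longrightarrow> s \<in> syms T \<Longrightarrow> s \<in> syms U \<Longrightarrow> \<exists>c. (r, c, s) \<in> T \<inter> U"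
    and "c \<in> cols T \<Longrightarrow> c \<in> cols U \<Longrightarrow> s \<in> syms T \<Longrightarrow> s \<in> syms U \<Longrightarrow> \<exists>r. (r, c, s) \<in> T \<inter> U"
proof -
  obtain m k where T': "latin_square m T" "T \<subseteq> L" and U': "latin_square k U" "U \<subseteq> L"
    using T U unfolding subsquare_def by blast
  note cell = latin_square_cell[OF T'(1)] latin_square_cell[OF U'(1)]
  note uniq = latin_square_unique[OF L]
  show "\<exists>s. (r, c, s) \<in> T \<inter> U"
    if rc: "r \<in> rows T" "r \<in> rows U" "c \<in> cols T" "c \<in> cols U"
  proof -
    obtain x y where "(r, c, x) \<in> T" "(r, c, y) \<in> U"
      using cell(1)[OF rc(1,3)] cell(4)[OF rc(2,4)] by blast
    moreover from this have "x = y" using uniq(1)[of r c x y] T'(2) U'(2) by blast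
    ultimately show ?thesis by blast
  qed
  show "\<exists>c. (r, c, s) \<in> T \<inter> U"
    if rs: "r \<in> rows T" "r \<in> rows U" "s \<in> syms T" "s \<in> syms U"
  proof -
    obtain x y where "(r, x, s) \<in> T" "(r, y, s) \<in> U"
      using cell(2)[OF rs(1,3)] cell(5)[OF rs(2,4)] by blast
    moreover from this have "x = y" using uniq(2)[of r x s y] T'(2) U'(2) by blast
    ultimately show ?thesis by blast
  qed
  show "\<exists>r. (r, c, s) \<in> T \<inter> U"
    if cs: "c \<in> cols T" "c \<in> cols U" "s \<in> syms T" "s \<in> syms U"
  proof -
    obtain x y where "(x, c, s) \<in> T" "(y, c, s) \<in> U"
      using cell(3)[OF cs(1,3)] cell(6)[OF cs(2,4)] by blast
    moreover from this have "x = y" using uniq(3)[of x c s y] T'(2) U'(2) by blast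
    ultimately show ?thesis by blast
  qed
qed

lemma latin_squareI:
  assumes fin: "finite L" and M: "latin_square n M" and L: "L \<subseteq> M"
    and rc: "\<And>r c. r \<in> rows L \<Longrightarrow> c \<in> cols L \<Longrightarrow> \<exists>s. (r, c, s) \<in> L"
    and rs: "\<And>r s. r \<in> rows L \<Longrightarrow> s \<in> syms L \<Longrightarrow> \<exists>c. (r, c, s) \<in> L"
    and cs: "\<And>c s. c \<in> cols L \<Longrightarrow> s \<in> syms L \<Longrightarrow> \<exists>r. (r, c, s) \<in> L"
  shows "\<exists>m. latin_square m L"
proof (cases "L = {}")
  case True
  then show ?thesis by (auto simp: latin_square_def rows_def cols_def syms_def)
next
  case False
  then obtain r0 c0 s0 where e0: "(r0, c0, s0) \<in> L" by auto
  note e0' = entry_lines[OF e0]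
  have u: "(r, c, s) \<in> L \<Longrightarrow> (r, c, s') \<in> L \<Longrightarrow> s = s'"
    "(r, c, s) \<in> L \<Longrightarrow> (r, c', s) \<in> L \<Longrightarrow> c = c'"
    "(r, c, s) \<in> L \<Longrightarrow> (r', c, s) \<in> L \<Longrightarrow> r = r'" for r r' c c' s s'
    using latin_square_unique[OF M] L by blast+
  obtain f where f: "\<And>c. c \<in> cols L \<Longrightarrow> (r0, c, f c) \<in> L"
    using rc[OF e0'(1)] by metis
  obtain g where g: "\<And>r. r \<in> rows L \<Longrightarrow> (r, c0, g r) \<in> L"
    using rc[OF _ e0'(2)] by metis
  have "bij_betw f (cols L) (syms L)"
  proof (rule bij_betw_imageI)
    show "inj_on f (cols L)"
    proof (rule inj_onI)
      fix x y assume "x \<in> cols L" "y \<in> cols L" "f x = f y"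
      then show "x = y" using f[of x] f[of y] u(2)[of r0 x "f x" y] by simp
    qed
    show "f ` cols L = syms L"
    proof
      show "f ` cols L \<subseteq> syms L" by (rule image_subsetI) (rule entry_lines(3)[OF f])
      show "syms L \<subseteq> f ` cols L"
      proof
        fix s assume "s \<in> syms L"
        then obtain c where c: "(r0, c, s) \<in> L" using rs[OF e0'(1)] by blast
        then have "c \<in> cols L" by (rule entry_lines)
        moreover from this have "s = f c" using u(1)[OF c f] by blast
        ultimately show "s \<in> f ` cols L" by blast
      qed
    qed
  qed
  moreover have "bij_betw g (rows L) (syms L)"
  proof (rule bij_betw_imageI)
    show "inj_on g (rows L)"
    proof (rule inj_onI)
      fix x y assume "x \<in> rows L" "y \<in> rows L" "g x = g y"
      then show "x = y" using g[of x] g[of y] u(3)[of x c0 "g x" y] by simp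
    qed
    show "g ` rows L = syms L"
    proof
      show "g ` rows L \<subseteq> syms L" by (rule image_subsetI) (rule entry_lines(3)[OF g])
      show "syms L \<subseteq> g ` rows L"
      proof
        fix s assume "s \<in> syms L"
        then obtain r where r: "(r, c0, s) \<in> L" using cs[OF e0'(2)] by blast
        then have "r \<in> rows L" by (rule entry_lines)
        moreover from this have "s = g r" using u(1)[OF r g] by blast
        ultimately show "s \<in> g ` rows L" by blast
      qed
    qed
  qed
  ultimately have "card (rows L) = card (syms L)" "card (cols L) = card (syms L)"
    by (auto dest: bij_betw_same_card)
  then show ?thesis
    unfolding latin_square_def using fin
    by (intro exI[of _ "card (syms L)"] conjI ballI ex_ex1I)
      (simp_all add: rc rs cs, (erule (1) u)+)
qed

lemma subsquare_Int:
  assumes L: "latin_square n L" and T: "subsquare T L" and U: "subsquare U L"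
  shows "subsquare (T \<inter> U) L"
proof -
  have s: "rows (T \<inter> U) \<subseteq> rows T \<inter> rows U" "cols (T \<inter> U) \<subseteq> cols T \<inter> cols U"
    "syms (T \<inter> U) \<subseteq> syms T \<inter> syms U"
    by (auto simp: rows_def cols_def syms_def)
  have sub: "T \<inter> U \<subseteq> L" "finite (T \<inter> U)"
    using T U L unfolding subsquare_def latin_square_def by auto
  have "\<exists>m. latin_square m (T \<inter> U)"
  proof (rule latin_squareI[OF sub(2) L sub(1)])
    fix r c s
    show "r \<in> rows (T \<inter> U) \<Longrightarrow> c \<in> cols (T \<inter> U) \<Longrightarrow> \<exists>s. (r, c, s) \<in> T \<inter> U"
      by (rule subsquare_Int_cell(1)[OF L T U]) (use s in blast)+
    show "r \<in> rows (T \<inter> U) \<Longrightarrow> s \<in> syms (T \<inter> U) \<Longrightarrow> \<exists>c. (r, c, s) \<in> T \<inter> U"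
      by (rule subsquare_Int_cell(2)[OF L T U]) (use s in blast)+
    show "c \<in> cols (T \<inter> U) \<Longrightarrow> s \<in> syms (T \<inter> U) \<Longrightarrow> \<exists>r. (r, c, s) \<in> T \<inter> U"
      by (rule subsquare_Int_cell(3)[OF L T U]) (use s in blast)+
  qed
  with sub show ?thesis by (simp add: subsquare_def)
qed

lemma intersects_Int:
  assumes L: "latin_square n L" and T: "subsquare T L" and U: "subsquare U L"
    and l: "l \<in> lines L" "intersects T l" "intersects U l" and ne: "T \<inter> U \<noteq> {}"
  shows "intersects (T \<inter> U) l"
proof -
  obtain r c s where e: "(r, c, s) \<in> T" "(r, c, s) \<in> U"
    using ne by auto
  note eT = entry_lines[OF e(1)] and eU = entry_lines[OF e(2)]
  note cell = subsquare_Int_cell[OF L T U]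
  have TL: "T \<subseteq> L" using T by (simp add: subsquare_def)
  consider (r) r' where "l = {e \<in> L. row_of e = r'}" | (c) c' where "l = {e \<in> L. col_of e = c'}"
    | (s) s' where "l = {e \<in> L. sym_of e = s'}"
    using l(1) unfolding lines_def by blast
  then show ?thesis
  proof cases
    case r
    then have "r' \<in> rows T" "r' \<in> rows U" using l by (force simp: intersects_def rows_def)+
    then obtain x where "(r', c, x) \<in> T \<inter> U" using cell(1) eT eU by blast
    then show ?thesis using r TL by (force simp: intersects_def)
  next
    case c
    then have "c' \<in> cols T" "c' \<in> cols U" using l by (force simp: intersects_def cols_def)+
    then obtain x where "(r, c', x) \<in> T \<inter> U" using cell(1) eT eU by blast
    then show ?thesis using c TL by (force simp: intersects_def)
  next
    case s
    then have "s' \<in> syms T" "s' \<in> syms U" using l by (force simp: intersects_def syms_def)+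
    then obtain x where "(r, x, s') \<in> T \<inter> U" using cell(2) eT eU by blast
    then show ?thesis using s TL by (force simp: intersects_def)
  qed
qed

lemma smallest_subsquare_least:
  assumes L: "latin_square n L" and l: "l \<in> lines L" and P: "P \<noteq> {}"
    and T: "smallest_subsquare L l P T"
    and U: "subsquare U L" "intersects U l" "P \<subseteq> U"
  shows "T \<subseteq> U"
proof -
  have T': "subsquare T L" "intersects T l" "P \<subseteq> T"
    and min: "\<And>V. subsquare V L \<Longrightarrow> intersects V l \<Longrightarrow> P \<subseteq> V \<Longrightarrow> card T \<le> card V"
    using T by (auto simp: smallest_subsquare_def is_arg_min_def not_less)
  have ne: "T \<inter> U \<noteq> {}" using P T' U by blast
  have "card T \<le> card (T \<inter> U)"
    using min[OF subsquare_Int[OF L T'(1) U(1)]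
        intersects_Int[OF L T'(1) U(1) l T'(2) U(2) ne]] T'(3) U(3)
    by blast
  moreover have "finite T" using T'(1) by (auto simp: subsquare_def latin_square_def)
  ultimately have "T \<inter> U = T" by (intro card_seteq) auto
  then show ?thesis by blast
qed

end

theory Submission
  imports Defs
begin

text \<open>
  Each new entry of a cover-sequence represents one, two or three new lines, so a cover-sequence of
  length \<open>d\<close> wastes \<open>3 n - d\<close> lines, the first entry wasting two of them.

  Given a connected chain, represent the lines of \<open>S\<^sub>i\<close> one subsquare at a time. Passing from
  \<open>S\<^sub>i\<^sub>-\<^sub>1\<close> to \<open>S\<^sub>i\<close> starts with an entry on the new line and on an old one, which wastes one line;
  then add entries representing exactly one new line for as long as possible. This stops
  only when the represented lines are those of a subsquare, which is \<open>S\<^sub>i\<close> by minimality.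

  Conversely, follow a cover-sequence with a connected chain whose current subsquare contains the
  entries read so far. An entry outside the subsquare has at most one line meeting it. If it has
  exactly one, it wastes at least one line and one step of the chain absorbs it; if it has none, it
  wastes two lines and two steps suffice.
\<close>

section \<open>Labels of lines\<close>

text \<open>The tagged sum keeps rows, columns and symbols apart even if their types coincide, so
  one \<open>card\<close> counts the represented lines of all three kinds.\<close>

definition labels_of :: "('r, 'c, 's) entry \<Rightarrow> ('r + 'c + 's) set" where
  "labels_of e = {Inl (row_of e), Inr (Inl (col_of e)), Inr (Inr (sym_of e))}"

definition labels :: "('r, 'c, 's) entry set \<Rightarrow> ('r + 'c + 's) set" where
  "labels E = (\<Union>e\<in>E. labels_of e)"

lemma labels_iff [simp]:
  "Inl r \<in> labels E \<longleftrightarrow> r \<in> rows E"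
  "Inr (Inl c) \<in> labels E \<longleftrightarrow> c \<in> cols E"
  "Inr (Inr s) \<in> labels E \<longleftrightarrow> s \<in> syms E"
  by (auto simp: labels_def labels_of_def rows_def cols_def syms_def)

lemma labels_eq: "labels E = rows E <+> cols E <+> syms E"
  by (auto simp: labels_def labels_of_def rows_def cols_def syms_def)

lemma labels_mono: "A \<subseteq> B \<Longrightarrow> labels A \<subseteq> labels B"
  by (auto simp: labels_def)

lemma labels_of_subset: "e \<in> E \<Longrightarrow> labels_of e \<subseteq> labels E"
  by (auto simp: labels_def)

lemma labels_empty [simp]: "labels {} = {}"
  by (simp add: labels_def)

lemma labels_insert [simp]: "labels (insert e E) = labels_of e \<union> labels E"
  by (simp add: labels_def)

lemma finite_labels_of [simp]: "finite (labels_of e)"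
  by (simp add: labels_of_def)

lemma finite_labels: "finite E \<Longrightarrow> finite (labels E)"
  by (simp add: labels_def)

lemma card_labels_of [simp]: "card (labels_of e) = 3"
  by (simp add: labels_of_def)

lemma card_labels_latin_square:
  assumes "latin_square n L"
  shows "card (labels L) = 3 * n"
proof -
  have "finite (rows L)" "finite (cols L)" "finite (syms L)"
    using assms by (auto simp: latin_square_def rows_def cols_def syms_def)
  then show ?thesis
    using assms by (simp add: labels_eq card_Plus latin_square_def)
qed

lemma labels_eq_iff:
  "labels A = labels B \<longleftrightarrow> rows A = rows B \<and> cols A = cols B \<and> syms A = syms B"
  by (metis labels_eq labels_iff subsetI subset_antisym)

lemma lines_eq: "lines L = {{e \<in> L. x \<in> labels_of e} | x. x \<in> labels L}"
proof -
  have "{{e \<in> L. x \<in> labels_of e} | x. x \<in> labels L} =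
      (\<lambda>x. {e \<in> L. x \<in> labels_of e}) ` (rows L <+> cols L <+> syms L)"
    by (auto simp: labels_eq)
  then show ?thesis
    by (auto simp: lines_def labels_of_def image_Un Plus_def image_image)
qed

lemma intersects_line_iff:
  assumes "T \<subseteq> L"
  shows "intersects T {e \<in> L. x \<in> labels_of e} \<longleftrightarrow> x \<in> labels T"
  using assms by (auto simp: intersects_def labels_def)

section \<open>Subsquares and their labels\<close>

lemma subsquare_finite: "subsquare T L \<Longrightarrow> finite T"
  by (auto simp: subsquare_def latin_square_def)

text \<open>Distinct labels of one entry are of different kinds. \<open>T\<close> has an entry with
  the same two labels, and by uniqueness in \<open>L\<close> that entry is \<open>e\<close>.\<close>

lemma subsquare_memI:
  assumes L: "latin_square n L" and T: "subsquare T L" and e: "e \<in> L"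
    and x: "x \<in> labels_of e" "x \<in> labels T" and y: "y \<in> labels_of e" "y \<in> labels T"
    and xy: "x \<noteq> y"
  shows "e \<in> T"
proof -
  obtain m where T': "latin_square m T" "T \<subseteq> L"
    using T by (auto simp: subsquare_def)
  obtain r c s where rcs: "e = (r, c, s)" by (cases e)
  note u = latin_square_unique[OF L] and cell = latin_square_cell[OF T'(1)]
  have "r \<in> rows T \<and> c \<in> cols T \<or> r \<in> rows T \<and> s \<in> syms T \<or> c \<in> cols T \<and> s \<in> syms T"
    using x y xy by (auto simp: rcs labels_of_def)
  then show ?thesis
    using u[of r c s] cell e T'(2) unfolding rcs by blast
qed

lemma card_labels_outside:
  assumes L: "latin_square n L" and T: "subsquare T L" and e: "e \<in> L" "e \<notin> T"
  shows "card (labels_of e - labels T) \<ge> 2"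
proof -
  have "card (labels_of e \<inter> labels T) \<le> 1"
    using subsquare_memI[OF L T e(1)] e(2) by (auto simp: card_le_Suc0_iff_eq)
  then show ?thesis
    using card_Int_Diff[of "labels_of e" "labels T"] by simp
qed

text \<open>A missing entry would have two labels outside \<open>labels T\<close>. This recognises
  when a chain has reached \<open>L\<close>.\<close>

lemma subsquare_eqI:
  assumes L: "latin_square n L" and T: "subsquare T L" and lab: "labels L \<subseteq> labels T"
  shows "T = L"
proof -
  have "e \<in> T" if "e \<in> L" for e
    using card_labels_outside[OF L T that] lab labels_of_subset[OF that]
    by (metis Diff_eq_empty_iff card.empty not_numeral_le_zero order_trans)
  then show ?thesis using T by (auto simp: subsquare_def)
qed

text \<open>Two lines of different kinds met by the filtered set have their labels in
  \<open>M\<close>, and their common entry in \<open>T\<close> then has its third label in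
  \<open>M\<close> as well. So the filtered set has all its cells filled, and
  \<open>latin_squareI\<close> applies.\<close>

lemma subsquare_closed_labels:
  assumes L: "latin_square n L" and T: "subsquare T L" and M: "M \<subseteq> labels T"
    and closed: "\<And>e x y. e \<in> T \<Longrightarrow> x \<in> labels_of e \<inter> M \<Longrightarrow> y \<in> labels_of e \<inter> M \<Longrightarrow> x \<noteq> y
      \<Longrightarrow> labels_of e \<subseteq> M"
  shows "subsquare {e \<in> T. labels_of e \<subseteq> M} L"
proof -
  let ?U = "{e \<in> T. labels_of e \<subseteq> M}"
  obtain m where T': "latin_square m T" "T \<subseteq> L"
    using T by (auto simp: subsquare_def)
  note cell = latin_square_cell[OF T'(1)]
  have lab: "labels ?U \<subseteq> M" by (auto simp: labels_def)
  have labT: "labels ?U \<subseteq> labels T" by (rule labels_mono) auto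
  have r: "Inl r \<in> M" "r \<in> rows T" if "r \<in> rows ?U" for r
    using that subsetD[OF lab, of "Inl r"] subsetD[OF labT, of "Inl r"] by simp_all
  have c: "Inr (Inl c) \<in> M" "c \<in> cols T" if "c \<in> cols ?U" for c
    using that subsetD[OF lab, of "Inr (Inl c)"] subsetD[OF labT, of "Inr (Inl c)"] by simp_all
  have s: "Inr (Inr s) \<in> M" "s \<in> syms T" if "s \<in> syms ?U" for s
    using that subsetD[OF lab, of "Inr (Inr s)"] subsetD[OF labT, of "Inr (Inr s)"] by simp_all
  have "\<exists>m. latin_square m ?U"
  proof (rule latin_squareI[OF _ L])
    show "finite ?U" using subsquare_finite[OF T] by simp
    show "?U \<subseteq> L" using T' by auto
    show "\<exists>s. (r, c, s) \<in> ?U" if rc: "r \<in> rows ?U" "c \<in> cols ?U" for r c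
    proof -
      obtain s where e: "(r, c, s) \<in> T" using cell(1) r(2) c(2) rc by blast
      have "labels_of (r, c, s) \<subseteq> M"
        by (rule closed[OF e, of "Inl r" "Inr (Inl c)"])
          (use r(1)[OF rc(1)] c(1)[OF rc(2)] in \<open>simp_all add: labels_of_def\<close>)
      with e show ?thesis by blast
    qed
    show "\<exists>c. (r, c, s) \<in> ?U" if rs: "r \<in> rows ?U" "s \<in> syms ?U" for r s
    proof -
      obtain c where e: "(r, c, s) \<in> T" using cell(2) r(2) s(2) rs by blast
      have "labels_of (r, c, s) \<subseteq> M"
        by (rule closed[OF e, of "Inl r" "Inr (Inr s)"])
          (use r(1)[OF rs(1)] s(1)[OF rs(2)] in \<open>simp_all add: labels_of_def\<close>)
      with e show ?thesis by blast
    qed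
    show "\<exists>r. (r, c, s) \<in> ?U" if cs: "c \<in> cols ?U" "s \<in> syms ?U" for c s
    proof -
      obtain r where e: "(r, c, s) \<in> T" using cell(3) c(2) s(2) cs by blast
      have "labels_of (r, c, s) \<subseteq> M"
        by (rule closed[OF e, of "Inr (Inl c)" "Inr (Inr s)"])
          (use c(1)[OF cs(1)] s(1)[OF cs(2)] in \<open>simp_all add: labels_of_def\<close>)
      with e show ?thesis by blast
    qed
  qed
  then show ?thesis using T' by (auto simp: subsquare_def)
qed

text \<open>Pair the new line with a line of \<open>S\<close> of another kind: as a Latin square,
  \<open>T\<close> has an entry on both.\<close>

lemma entry_on_new_and_old_line:
  assumes T: "latin_square m T" and S: "S \<subseteq> T" "S \<noteq> {}" and x: "x \<in> labels T" "x \<notin> labels S"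
  obtains e where "e \<in> T" "x \<in> labels_of e" "labels_of e \<inter> labels S \<noteq> {}"
proof -
  obtain r c s where e: "(r, c, s) \<in> S" using S(2) by auto
  note eS = entry_lines[OF e] and eT = entry_lines[OF subsetD[OF S(1) e]]
  note cell = latin_square_cell[OF T]
  have "\<exists>e \<in> T. x \<in> labels_of e \<and> labels_of e \<inter> labels S \<noteq> {}"
  proof -
    consider (r) r' where "x = Inl r'" "r' \<in> rows T"
      | (c) c' where "x = Inr (Inl c')" "c' \<in> cols T"
      | (s) s' where "x = Inr (Inr s')" "s' \<in> syms T"
      using x(1) by (auto simp: labels_eq)
    then show ?thesis
    proof cases
      case r
      then obtain s' where "(r', c, s') \<in> T" using cell(1) eT by blast
      then show ?thesis using r eS by (force simp: labels_of_def)
    next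
      case c
      then obtain s' where "(r, c', s') \<in> T" using cell(1) eT by blast
      then show ?thesis using c eS by (force simp: labels_of_def)
    next
      case s
      then obtain c' where "(r, c', s') \<in> T" using cell(2) eT by blast
      then show ?thesis using s eS by (force simp: labels_of_def)
    qed
  qed
  then show ?thesis using that by blast
qed

section \<open>Connected chains\<close>

text \<open>
  \<open>conn L k S\<close>: some sequence starting like a connected chain of \<open>L\<close> reaches \<open>S\<close> after \<open>k\<close> steps.
  The first step is not constrained beyond being a single entry, as the connectedness condition
  holds for it automatically.
\<close>

inductive conn :: "('r, 'c, 's) entry set \<Rightarrow> nat \<Rightarrow> ('r, 'c, 's) entry set \<Rightarrow> bool" for L where
  start: "e \<in> L \<Longrightarrow> conn L 1 {e}"
| step: "conn L k S \<Longrightarrow> l \<in> lines L \<Longrightarrow> \<not> intersects S l \<Longrightarrow> smallest_subsquare L l S T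
    \<Longrightarrow> conn L (Suc k) T"

lemma smallest_subsquareD:
  assumes "smallest_subsquare L l P T"
  shows "subsquare T L" "intersects T l" "P \<subseteq> T"
  using assms by (auto simp: smallest_subsquare_def is_arg_min_def)

lemma subsquare_self: "latin_square n L \<Longrightarrow> subsquare L L"
  by (auto simp: subsquare_def)

lemma subsquare_empty: "subsquare {} L"
  by (auto simp: subsquare_def latin_square_def rows_def cols_def syms_def)

lemma subsquare_single: "e \<in> L \<Longrightarrow> subsquare {e} L"
  by (cases e) (auto simp: subsquare_def latin_square_def rows_def cols_def syms_def)

lemma conn_subsquare: "conn L k S \<Longrightarrow> subsquare S L"
  by (induction rule: conn.induct) (auto intro: subsquare_single smallest_subsquareD)

lemma conn_ne: "conn L k S \<Longrightarrow> S \<noteq> {}"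
  by (induction rule: conn.induct) (auto dest: smallest_subsquareD)

text \<open>\<open>L\<close> itself contains \<open>S\<close> and meets the line, so a candidate
  with the fewest entries exists.\<close>

lemma conn_step_label:
  assumes L: "latin_square n L" and S: "conn L k S" and x: "x \<in> labels L" "x \<notin> labels S"
  obtains T where "conn L (Suc k) T" "S \<subseteq> T" "x \<in> labels T"
proof -
  let ?l = "{e \<in> L. x \<in> labels_of e}"
  let ?P = "\<lambda>T. subsquare T L \<and> intersects T ?l \<and> S \<subseteq> T"
  have SL: "S \<subseteq> L" using conn_subsquare[OF S] by (simp add: subsquare_def)
  have "?P L"
    using subsquare_self[OF L] SL x(1) by (simp add: intersects_line_iff)
  then obtain T where "is_arg_min card ?P T"
    using ex_has_least_nat[of ?P L card] by (auto simp: is_arg_min_linorder)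
  then have T: "smallest_subsquare L ?l S T" by (simp add: smallest_subsquare_def)
  note T' = smallest_subsquareD[OF T]
  have "conn L (Suc k) T"
    using S _ _ T by (rule conn.step) (use x SL in \<open>auto simp: lines_eq intersects_line_iff\<close>)
  moreover have "x \<in> labels T"
    using T'(1,2) by (simp add: intersects_line_iff subsquare_def)
  ultimately show ?thesis using that T'(3) by blast
qed

text \<open>A reachable subsquare with the most entries meets every line, since a further step would
  enlarge it. Hence the minimum defining \<open>scc\<close> is attained.\<close>

lemma conn_exists:
  assumes L: "latin_square n L" and "L \<noteq> {}"
  shows "\<exists>k. conn L k L"
proof -
  let ?P = "\<lambda>T. \<exists>k. conn L k T"
  have finL: "finite L" by (rule subsquare_finite[OF subsquare_self[OF L]])
  obtain e where "e \<in> L" using assms(2) by blast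
  then have "?P {e}" using conn.start by blast
  moreover have "card T < card L + 1" if "?P T" for T
  proof -
    have "T \<subseteq> L" using that conn_subsquare by (auto simp: subsquare_def)
    then show ?thesis using card_mono[OF finL] by (simp add: less_Suc_eq_le)
  qed
  ultimately obtain k T where T: "conn L k T" and max: "\<And>U. ?P U \<Longrightarrow> card U \<le> card T"
    using ex_has_greatest_nat[of ?P "{e}" card "card L + 1"] by blast
  have "labels L \<subseteq> labels T"
  proof
    fix x assume x: "x \<in> labels L"
    show "x \<in> labels T"
    proof (rule ccontr)
      assume xT: "x \<notin> labels T"
      obtain U where U: "conn L (Suc k) U" "T \<subseteq> U" "x \<in> labels U"
        using conn_step_label[OF L T x xT] .
      then have "T \<subset> U" using xT by blast
      then have "card T < card U"
        by (rule psubset_card_mono[OF subsquare_finite[OF conn_subsquare[OF U(1)]]])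
      moreover have "card U \<le> card T" using U(1) by (intro max exI)
      ultimately show False by simp
    qed
  qed
  then have "T = L" by (rule subsquare_eqI[OF L conn_subsquare[OF T]])
  then show ?thesis using T by blast
qed

section \<open>Agreement of \<open>conn\<close> with connected chains\<close>

lemma connected_chain_imp_conn:
  assumes "connected_chain L \<alpha> S"
  shows "conn L \<alpha> L"
proof -
  have ch: "1 \<le> \<alpha>" "S \<alpha> = L" and sub: "\<And>i. i \<le> \<alpha> \<Longrightarrow> S i \<subseteq> L"
    and s1: "\<exists>e. S 1 = {e}"
    and st: "\<And>i. 1 \<le> i \<Longrightarrow> i \<le> \<alpha> \<Longrightarrow> \<exists>l \<in> lines L. intersects (S i) l \<and>
      \<not> intersects (S (i - 1)) l \<and> smallest_subsquare L l (S (i - 1)) (S i)"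
    using assms by (auto simp: connected_chain_def chain_def subsquare_def)
  have "i \<le> \<alpha> \<longrightarrow> conn L i (S i)" if "1 \<le> i" for i
    using that
  proof (induction i rule: dec_induct)
    case base
    show ?case using s1 sub[of 1] by (auto intro: conn.start[simplified])
  next
    case (step i)
    then show ?case using st[of "Suc i"] by (auto intro: conn.step)
  qed
  then show ?thesis using ch by force
qed

lemma conn_imp_sequence:
  assumes "conn L k S"
  shows "\<exists>f. k \<ge> 1 \<and> f 0 = {} \<and> (\<exists>e \<in> L. f 1 = {e}) \<and> f k = S \<and>
    (\<forall>i. 1 \<le> i \<and> i \<le> k \<longrightarrow> (\<exists>l \<in> lines L. \<not> intersects (f (i - 1)) l \<and>
       smallest_subsquare L l (f (i - 1)) (f i)))"
  using assms
proof (induction rule: conn.induct)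
  case (start e)
  \<comment> \<open>Any line through \<open>e\<close> would serve; its row is taken. A subsquare
    meeting it has at least one entry, so the single entry \<open>e\<close> is smallest.\<close>
  let ?l = "{e' \<in> L. Inl (row_of e) \<in> labels_of e'}"
  have l: "?l \<in> lines L" "intersects {e} ?l"
    using start labels_of_subset[OF start] by (auto simp: lines_eq labels_of_def intersects_def)
  have "card T \<ge> 1" if "subsquare T L" "intersects T ?l" for T
    using that subsquare_finite[OF that(1)]
    by (auto simp: intersects_def Suc_le_eq card_gt_0_iff)
  then have "smallest_subsquare L ?l {} {e}"
    using l(2) subsquare_single[OF start]
    by (auto simp: smallest_subsquare_def is_arg_min_linorder)
  moreover have "\<not> intersects {} ?l" by (simp add: intersects_def)
  ultimately show ?case
    using start l by (intro exI[of _ "\<lambda>i. if i = 0 then {} else {e}"]) (auto intro!: bexI[of _ ?l])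
next
  case (step k S l T)
  then obtain f where f: "k \<ge> 1" "f 0 = {}" "\<exists>e \<in> L. f 1 = {e}" "f k = S"
    and st: "\<And>i. 1 \<le> i \<Longrightarrow> i \<le> k \<Longrightarrow> \<exists>l \<in> lines L. \<not> intersects (f (i - 1)) l \<and>
       smallest_subsquare L l (f (i - 1)) (f i)"
    by auto
  let ?g = "f(Suc k := T)"
  have "\<exists>l \<in> lines L. \<not> intersects (?g (i - 1)) l \<and> smallest_subsquare L l (?g (i - 1)) (?g i)"
    if i: "1 \<le> i" "i \<le> Suc k" for i
  proof (cases "i = Suc k")
    case True
    then show ?thesis using step.hyps f(4) by auto
  next
    case False
    then show ?thesis using st[of i] i by auto
  qed
  then show ?case using f by (intro exI[of _ ?g]) auto
qed

lemma conn_imp_connected_chain: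
  assumes "conn L k L"
  shows "\<exists>S. connected_chain L k S"
proof -
  obtain f where f: "k \<ge> 1" "f 0 = {}" "\<exists>e \<in> L. f 1 = {e}" "f k = L"
    and st: "\<And>i. 1 \<le> i \<Longrightarrow> i \<le> k \<Longrightarrow> \<exists>l \<in> lines L. \<not> intersects (f (i - 1)) l \<and>
       smallest_subsquare L l (f (i - 1)) (f i)"
    using conn_imp_sequence[OF assms] by blast
  have "subsquare (f i) L" if "i \<le> k" for i
    using that st[of i] f(2) by (cases i) (auto intro: subsquare_empty smallest_subsquareD)
  moreover have "f i \<subseteq> f (Suc i)" if "i < k" for i
    using that st[of "Suc i"] smallest_subsquareD(3) by fastforce
  moreover have "\<exists>l \<in> lines L. intersects (f i) l \<and> \<not> intersects (f (i - 1)) l \<and>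
       smallest_subsquare L l (f (i - 1)) (f i)" if "1 \<le> i" "i \<le> k" for i
    using st[OF that] smallest_subsquareD(2) by blast
  ultimately have "connected_chain L k f"
    using f unfolding connected_chain_def chain_def by blast
  then show ?thesis by blast
qed

lemma scc_eq: "scc L = (LEAST k. conn L k L)"
  unfolding scc_def using connected_chain_imp_conn conn_imp_connected_chain by metis

section \<open>Cover-sequences\<close>

text \<open>Condition (2) of a cover-sequence apart from (1), so that it passes to prefixes and
  allows induction entry by entry.\<close>

definition fresh :: "('r, 'c, 's) entry list \<Rightarrow> bool" where
  "fresh es \<longleftrightarrow> (\<forall>i < length es. \<not> labels_of (es ! i) \<subseteq> labels (set (take i es)))"

lemma fresh_Nil [simp]: "fresh []"
  by (simp add: fresh_def)

lemma fresh_snoc [simp]: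
  "fresh (es @ [e]) \<longleftrightarrow> fresh es \<and> \<not> labels_of e \<subseteq> labels (set es)"
  by (auto simp: fresh_def nth_append less_Suc_eq)

lemma cover_sequence_iff:
  "cover_sequence L es \<longleftrightarrow> set es \<subseteq> L \<and> labels (set es) = labels L \<and> fresh es"
  by (auto simp: cover_sequence_def labels_eq_iff fresh_def labels_of_def)

lemma card_labels_insert:
  "finite E \<Longrightarrow> card (labels (insert e E)) = card (labels E) + card (labels_of e - labels E)"
  by (simp add: Un_commute[of "labels_of e"] finite_labels
      card_Un_disjoint[of "labels E" "labels_of e - labels E", simplified])

section \<open>From cover-sequences to chains\<close>

text \<open>The waste, \<open>card (labels (set es))\<close> minus \<open>length es\<close>, stays
  at least \<open>k + 1\<close>. It is 2 for one entry and \<open>k = 1\<close>, and it then grows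
  by at least the number of steps taken to absorb each new entry.\<close>

lemma fresh_imp_conn:
  assumes L: "latin_square n L" and "set es \<subseteq> L" "fresh es" "es \<noteq> []"
  shows "\<exists>k T. conn L k T \<and> set es \<subseteq> T \<and> length es + k + 1 \<le> card (labels (set es))"
  using assms(2-)
proof (induction es rule: rev_induct)
  case Nil
  then show ?case by simp
next
  case (snoc e es)
  have eL: "e \<in> L" using snoc.prems by simp
  show ?case
  proof (cases "es = []")
    case True
    then show ?thesis using conn.start[OF eL] by (intro exI[of _ 1] exI[of _ "{e}"]) simp
  next
    case False
    then obtain k T where T: "conn L k T" "set es \<subseteq> T"
      and len: "length es + k + 1 \<le> card (labels (set es))"
      using snoc by auto
    note subT = conn_subsquare[OF T(1)]
    have card: "card (labels (set (es @ [e]))) =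
        card (labels (set es)) + card (labels_of e - labels (set es))"
      using card_labels_insert[of "set es" e] by simp
    \<comment> \<open>Labels new to \<open>T\<close> are new to \<open>es\<close>, so counts made
      relative to \<open>T\<close> bound the growth from below.\<close>
    have le: "card (labels_of e - labels T) \<le> card (labels_of e - labels (set es))"
      using labels_mono[OF T(2)] by (intro card_mono) auto
    show ?thesis
    proof (cases "e \<in> T")
      case True
      have "card (labels_of e - labels (set es)) \<ge> 1"
        using snoc.prems by (simp add: Suc_le_eq card_gt_0_iff)
      then show ?thesis using T True len card by (intro exI[of _ k] exI[of _ T]) simp
    next
      case eT: False
      have two: "card (labels_of e - labels T) \<ge> 2"
        by (rule card_labels_outside[OF L subT eL eT])
      then have "labels_of e - labels T \<noteq> {}" by force
      then obtain x where x: "x \<in> labels_of e" "x \<notin> labels T" by blast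
      obtain T' where T': "conn L (Suc k) T'" "T \<subseteq> T'" "x \<in> labels T'"
        using conn_step_label[OF L T(1) _ x(2)] x(1) labels_of_subset[OF eL] by blast
      show ?thesis
      proof (cases "e \<in> T'")
        case True
        then show ?thesis
          using T' T(2) len card le two by (intro exI[of _ "Suc k"] exI[of _ T']) auto
      next
        case eT': False
        note subT' = conn_subsquare[OF T'(1)]
        have "labels_of e - labels T' \<noteq> {}"
          using card_labels_outside[OF L subT' eL eT'] by force
        then obtain y where y: "y \<in> labels_of e" "y \<notin> labels T'" by blast
        obtain T'' where T'': "conn L (Suc (Suc k)) T''" "T' \<subseteq> T''" "y \<in> labels T''"
          using conn_step_label[OF L T'(1) _ y(2)] y(1) labels_of_subset[OF eL] by blast
        \<comment> \<open>After two steps the subsquare meets two lines of \<open>e\<close>, hence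
          contains \<open>e\<close>.\<close>
        have "x \<noteq> y" using T'(3) y(2) by blast
        then have "e \<in> T''"
          using subsquare_memI[OF L conn_subsquare[OF T''(1)] eL x(1) _ y(1) T''(3)]
            labels_mono[OF T''(2)] T'(3) by blast
        \<comment> \<open>A label of \<open>e\<close> in \<open>labels T\<close> would, together
          with \<open>x\<close>, put \<open>e\<close> into \<open>T'\<close>. So all three labels
          are new, which pays for the two steps.\<close>
        moreover have "labels_of e \<inter> labels T = {}"
          using subsquare_memI[OF L subT' eL x(1) T'(3)] eT' x(2) labels_mono[OF T'(2)] by blast
        then have "card (labels_of e - labels T) = 3" by (simp add: Diff_triv)
        ultimately show ?thesis
          using T''(1,2) T'(2) T(2) len card le
          by (intro exI[of _ "Suc (Suc k)"] exI[of _ T'']) auto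
      qed
    qed
  qed
qed

section \<open>From chains to cover-sequences\<close>

text \<open>Take a longest extension within \<open>T\<close> of unchanged waste, which is what the
  equation on lengths says. An entry of \<open>T\<close> with exactly two represented labels could
  still be appended, so the represented labels are closed in the sense of
  \<open>subsquare_closed_labels\<close>.\<close>

lemma fresh_extend_to_subsquare:
  assumes L: "latin_square n L" and T: "subsquare T L"
    and es: "set es \<subseteq> T" "fresh es"
  obtains fs where "set es \<subseteq> set fs" "set fs \<subseteq> T" "fresh fs"
    "length fs + card (labels (set es)) = length es + card (labels (set fs))"
    "subsquare {e \<in> T. labels_of e \<subseteq> labels (set fs)} L"
proof -
  let ?P = "\<lambda>fs. set es \<subseteq> set fs \<and> set fs \<subseteq> T \<and> fresh fs \<and>
    length fs + card (labels (set es)) = length es + card (labels (set fs))"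
  have finT: "finite T" by (rule subsquare_finite[OF T])
  \<comment> \<open>The equation bounds the length, so a longest extension exists.\<close>
  have "length fs \<le> length es + card (labels T)" if "?P fs" for fs
    using that card_mono[OF finite_labels[OF finT] labels_mono, of "set fs"] by linarith
  moreover have "?P es" using es by simp
  ultimately obtain fs where fs: "?P fs" and max: "\<And>gs. ?P gs \<Longrightarrow> length gs \<le> length fs"
    using ex_has_greatest_nat[of ?P es length "length es + card (labels T) + 1"]
    by (metis (no_types, lifting) Suc_eq_plus1 le_imp_less_Suc)
  have "labels_of e \<subseteq> labels (set fs)"
    if e: "e \<in> T" and x: "x \<in> labels_of e \<inter> labels (set fs)"
      and y: "y \<in> labels_of e \<inter> labels (set fs)" and "x \<noteq> y" for e x y
  proof (rule ccontr)
    assume new: "\<not> labels_of e \<subseteq> labels (set fs)"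
    have "card {x, y} \<le> card (labels_of e \<inter> labels (set fs))"
      using x y by (intro card_mono) auto
    then have "card (labels_of e - labels (set fs)) \<le> 1"
      using card_Int_Diff[of "labels_of e" "labels (set fs)"] \<open>x \<noteq> y\<close> by simp
    moreover have "card (labels_of e - labels (set fs)) \<ge> 1"
      using new by (simp add: Suc_le_eq card_gt_0_iff)
    ultimately have "card (labels (set (fs @ [e]))) = card (labels (set fs)) + 1"
      using card_labels_insert[of "set fs" e] by simp
    then have "?P (fs @ [e])" using fs e new by auto
    from max[OF this] show False by simp
  qed
  then have "subsquare {e \<in> T. labels_of e \<subseteq> labels (set fs)} L"
    using fs by (intro subsquare_closed_labels[OF L T] labels_mono) auto
  then show ?thesis using fs that by blast
qed

text \<open>Here the waste is exactly \<open>k + 1\<close>: each step of the chain wastes one line,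
  on its first entry, and all further entries of the step waste none.\<close>

lemma conn_imp_fresh:
  assumes L: "latin_square n L" and "conn L k S"
  shows "\<exists>es. set es \<subseteq> S \<and> labels (set es) = labels S \<and> fresh es \<and>
    length es + k + 1 = card (labels S)"
  using assms(2)
proof (induction rule: conn.induct)
  case (start e)
  have "fresh ([] @ [e])" by (simp only: fresh_snoc) (simp add: labels_of_def)
  then show ?case by (intro exI[of _ "[e]"]) simp
next
  case (step k S l T)
  then obtain es where es: "set es \<subseteq> S" "labels (set es) = labels S" "fresh es"
    and len: "length es + k + 1 = card (labels S)" by blast
  note T = smallest_subsquareD[OF step.hyps(4)]
  note S = conn_subsquare[OF step.hyps(1)] conn_ne[OF step.hyps(1)]
  have SL: "S \<subseteq> L" and TL: "T \<subseteq> L" using S(1) T(1) by (auto simp: subsquare_def)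
  obtain m where mT: "latin_square m T" using T(1) by (auto simp: subsquare_def)
  obtain x where x: "x \<in> labels T" "x \<notin> labels S" and l: "l = {e \<in> L. x \<in> labels_of e}"
    using step.hyps(2,3) T(2) SL TL by (auto simp: lines_eq intersects_line_iff)
  obtain e where e: "e \<in> T" "x \<in> labels_of e" "labels_of e \<inter> labels S \<noteq> {}"
    using entry_on_new_and_old_line[OF mT T(3) S(2) x] .
  have "e \<notin> S" using e(2) x(2) by (auto simp: labels_def)
  then have "card (labels_of e - labels S) \<ge> 2"
    using card_labels_outside[OF L S(1)] e(1) TL by blast
  moreover have "card (labels_of e \<inter> labels S) \<ge> 1"
    using e(3) by (simp add: Suc_le_eq card_gt_0_iff)
  \<comment> \<open>Of the three labels at least two are new, as \<open>e\<close> lies outside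
    \<open>S\<close>, and at least one is old.\<close>
  ultimately have "card (labels_of e - labels S) = 2"
    using card_Int_Diff[of "labels_of e" "labels S"] by simp
  then have card: "card (labels (set (es @ [e]))) = card (labels S) + 2"
    using card_labels_insert[of "set es" e] es(2) by simp
  have "set (es @ [e]) \<subseteq> T" "fresh (es @ [e])"
    using es e T(3) x(2) by auto
  then obtain fs where fs: "set (es @ [e]) \<subseteq> set fs" "set fs \<subseteq> T" "fresh fs"
    and len': "length fs + card (labels (set (es @ [e]))) =
      length (es @ [e]) + card (labels (set fs))"
    and U: "subsquare {e \<in> T. labels_of e \<subseteq> labels (set fs)} L"
    by (rule fresh_extend_to_subsquare[OF L T(1)])
  let ?U = "{e \<in> T. labels_of e \<subseteq> labels (set fs)}"
  have "labels S \<subseteq> labels (set fs)" using es(2) labels_mono[OF fs(1)] by auto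
  then have "S \<subseteq> ?U" using T(3) labels_of_subset by blast
  moreover have "e \<in> ?U" using e(1) fs(1) labels_of_subset[of e "set fs"] by auto
  then have "intersects ?U l" using e(1,2) TL by (auto simp: l intersects_def)
  \<comment> \<open>The saturated subsquare contains \<open>S\<close> and meets \<open>l\<close>, so
    minimality of \<open>T\<close> forces every label of \<open>T\<close> to be represented.\<close>
  ultimately have "T \<subseteq> ?U"
    using smallest_subsquare_least[OF L step.hyps(2) S(2) step.hyps(4) U] by blast
  then have "labels (set fs) = labels T"
    using labels_mono[OF fs(2)] by (auto simp: labels_def)
  then show ?case using fs len len' card by (intro exI[of _ fs]) auto
qed

theorem theorem2p6:
  fixes L :: "('r, 'c, 's) entry set" and n :: nat
  assumes "latin_square n L" and "n \<ge> 1"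
  shows "int (mcs L) = 3 * int n - 1 - int (scc L)"
proof -
  note L = assms(1) and card = card_labels_latin_square[OF assms(1)]
  \<comment> \<open>A cover represents all \<open>3 * n\<close> labels, so the chain that follows it
    ends in \<open>L\<close>.\<close>
  have bound: "\<exists>k. conn L k L \<and> length es + k + 1 \<le> 3 * n" if es: "cover_sequence L es" for es
  proof -
    have es': "set es \<subseteq> L" "labels (set es) = labels L" "fresh es"
      using es by (auto simp: cover_sequence_iff)
    have "es \<noteq> []" using es'(2) card assms(2) by auto
    then obtain k T where T: "conn L k T" "set es \<subseteq> T" "length es + k + 1 \<le> 3 * n"
      using fresh_imp_conn[OF L es'(1,3)] es'(2) card by auto
    have "T = L"
      using subsquare_eqI[OF L conn_subsquare[OF T(1)]] labels_mono[OF T(2)] es'(2) by simp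
    then show ?thesis using T by blast
  qed
  have "L \<noteq> {}" using card assms(2) by auto
  then have "\<exists>k. conn L k L" by (rule conn_exists[OF L])
  then have scc: "conn L (scc L) L" unfolding scc_eq by (metis LeastI)
  \<comment> \<open>A shortest chain yields a cover-sequence that attains the bound.\<close>
  obtain es where es: "cover_sequence L es" "length es + scc L + 1 = 3 * n"
    using conn_imp_fresh[OF L scc] card by (auto simp: cover_sequence_iff)
  have "length es' \<le> length es" if es': "cover_sequence L es'" for es'
  proof -
    obtain k where k: "conn L k L" "length es' + k + 1 \<le> 3 * n" using bound[OF es'] by blast
    then have "scc L \<le> k" unfolding scc_eq by (intro Least_le)
    then show ?thesis using k es(2) by simp
  qed
  then have "mcs L = length es"
    unfolding mcs_def using es(1)
    by (intro Max_eqI finite_subset[OF _ finite_atMost[of "length es"]]) auto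
  then show ?thesis using es(2) by linarith
qed

end
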